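(* The category whose objects are metric spaces and whose morphisms are coarse maps modulo closeness has all finite colimits.
   Context: Metrics take only finite values. A subset $E\subseteq X\times X$ of the square of a metric space is an entourage if $\sup_{(x,y)\in E}d(x,y)<\infty$. A map $f:X\to Y$ between metric spaces is coarse if $(f\times f)(E)$ is an entourage for every entourage $E\subseteq X\times X$ and $f^{-1}(B)$ is bounded for every bounded $B\subseteq Y$. Maps $f,g:X\to Y$ are close if $\sup_{x\in X} d(f(x),g(x))<\infty$. *)

theory Defs
  imports "HOL-Analysis.Abstract_Metric_Spaces"
begin

section \<open>Categories, functors and colimits\<close>

text \<open>
  A category is given by its objects and a family of hom-sets. Hom-sets for different pairs of
  objects need not be disjoint, so composition, functors on arrows and so on carry the objects as
  indices: \<open>Comp \<C> A B C g f\<close> is the composite of \<open>f : A \<rightarrow> B\<close> and \<open>g : B \<rightarrow> C\<close>.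
\<close>

record ('o, 'm) cat =
  Obj :: "'o set"
  Hom :: "'o \<Rightarrow> 'o \<Rightarrow> 'm set"
  Comp :: "'o \<Rightarrow> 'o \<Rightarrow> 'o \<Rightarrow> 'm \<Rightarrow> 'm \<Rightarrow> 'm"
  Ident :: "'o \<Rightarrow> 'm"

definition is_category :: "('o, 'm) cat \<Rightarrow> bool" where
  "is_category \<C> \<longleftrightarrow>
     (\<forall>A\<in>Obj \<C>. Ident \<C> A \<in> Hom \<C> A A) \<and>
     (\<forall>A\<in>Obj \<C>. \<forall>B\<in>Obj \<C>. \<forall>C\<in>Obj \<C>. \<forall>f\<in>Hom \<C> A B. \<forall>g\<in>Hom \<C> B C.
        Comp \<C> A B C g f \<in> Hom \<C> A C) \<and>
     (\<forall>A\<in>Obj \<C>. \<forall>B\<in>Obj \<C>. \<forall>f\<in>Hom \<C> A B.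
        Comp \<C> A A B f (Ident \<C> A) = f \<and> Comp \<C> A B B (Ident \<C> B) f = f) \<and>
     (\<forall>A\<in>Obj \<C>. \<forall>B\<in>Obj \<C>. \<forall>C\<in>Obj \<C>. \<forall>D\<in>Obj \<C>.
        \<forall>f\<in>Hom \<C> A B. \<forall>g\<in>Hom \<C> B C. \<forall>h\<in>Hom \<C> C D.
        Comp \<C> A C D h (Comp \<C> A B C g f) = Comp \<C> A B D (Comp \<C> B C D h g) f)"

definition finite_category :: "('o, 'm) cat \<Rightarrow> bool" where
  "finite_category \<J> \<longleftrightarrow>
     is_category \<J> \<and> finite (Obj \<J>) \<and> (\<forall>i\<in>Obj \<J>. \<forall>j\<in>Obj \<J>. finite (Hom \<J> i j))"

definition is_functor ::
  "('j, 'k) cat \<Rightarrow> ('o, 'm) cat \<Rightarrow> ('j \<Rightarrow> 'o) \<Rightarrow> ('j \<Rightarrow> 'j \<Rightarrow> 'k \<Rightarrow> 'm) \<Rightarrow> bool" where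
  "is_functor \<J> \<C> F\<^sub>O F\<^sub>M \<longleftrightarrow>
     (\<forall>i\<in>Obj \<J>. F\<^sub>O i \<in> Obj \<C>) \<and>
     (\<forall>i\<in>Obj \<J>. \<forall>j\<in>Obj \<J>. \<forall>u\<in>Hom \<J> i j. F\<^sub>M i j u \<in> Hom \<C> (F\<^sub>O i) (F\<^sub>O j)) \<and>
     (\<forall>i\<in>Obj \<J>. F\<^sub>M i i (Ident \<J> i) = Ident \<C> (F\<^sub>O i)) \<and>
     (\<forall>i\<in>Obj \<J>. \<forall>j\<in>Obj \<J>. \<forall>k\<in>Obj \<J>. \<forall>u\<in>Hom \<J> i j. \<forall>v\<in>Hom \<J> j k.
        F\<^sub>M i k (Comp \<J> i j k v u)
          = Comp \<C> (F\<^sub>O i) (F\<^sub>O j) (F\<^sub>O k) (F\<^sub>M j k v) (F\<^sub>M i j u))"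

definition is_cocone ::
  "('j, 'k) cat \<Rightarrow> ('o, 'm) cat \<Rightarrow> ('j \<Rightarrow> 'o) \<Rightarrow> ('j \<Rightarrow> 'j \<Rightarrow> 'k \<Rightarrow> 'm) \<Rightarrow>
    'o \<Rightarrow> ('j \<Rightarrow> 'm) \<Rightarrow> bool" where
  "is_cocone \<J> \<C> F\<^sub>O F\<^sub>M V \<iota> \<longleftrightarrow>
     V \<in> Obj \<C> \<and>
     (\<forall>i\<in>Obj \<J>. \<iota> i \<in> Hom \<C> (F\<^sub>O i) V) \<and>
     (\<forall>i\<in>Obj \<J>. \<forall>j\<in>Obj \<J>. \<forall>u\<in>Hom \<J> i j.
        Comp \<C> (F\<^sub>O i) (F\<^sub>O j) V (\<iota> j) (F\<^sub>M i j u) = \<iota> i)"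

definition is_colimit ::
  "('j, 'k) cat \<Rightarrow> ('o, 'm) cat \<Rightarrow> ('j \<Rightarrow> 'o) \<Rightarrow> ('j \<Rightarrow> 'j \<Rightarrow> 'k \<Rightarrow> 'm) \<Rightarrow>
    'o \<Rightarrow> ('j \<Rightarrow> 'm) \<Rightarrow> bool" where
  "is_colimit \<J> \<C> F\<^sub>O F\<^sub>M V \<iota> \<longleftrightarrow>
     is_cocone \<J> \<C> F\<^sub>O F\<^sub>M V \<iota> \<and>
     (\<forall>W \<phi>. is_cocone \<J> \<C> F\<^sub>O F\<^sub>M W \<phi> \<longrightarrow>
        (\<exists>!h. h \<in> Hom \<C> V W \<and> (\<forall>i\<in>Obj \<J>. Comp \<C> (F\<^sub>O i) V W h (\<iota> i) = \<phi> i)))"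

definition has_colimits_of_shape :: "('j, 'k) cat \<Rightarrow> ('o, 'm) cat \<Rightarrow> bool" where
  "has_colimits_of_shape \<J> \<C> \<longleftrightarrow>
     (\<forall>F\<^sub>O F\<^sub>M. is_functor \<J> \<C> F\<^sub>O F\<^sub>M \<longrightarrow> (\<exists>V \<iota>. is_colimit \<J> \<C> F\<^sub>O F\<^sub>M V \<iota>))"


section \<open>Coarse maps and closeness\<close>

text \<open>
  A supremum of distances being finite is rendered as \<open>bdd_above\<close>, which holds for the empty set;
  the empty metric space is allowed.
\<close>

definition entourage :: "'a metric \<Rightarrow> ('a \<times> 'a) set \<Rightarrow> bool" where
  "entourage X E \<longleftrightarrow>
     E \<subseteq> mspace X \<times> mspace X \<and> bdd_above ((\<lambda>(x, y). mdist X x y) ` E)"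

definition bounded_in :: "'a metric \<Rightarrow> 'a set \<Rightarrow> bool" where
  "bounded_in X B \<longleftrightarrow> Metric_space.mbounded (mspace X) (mdist X) B"

definition coarse_map :: "'a metric \<Rightarrow> 'b metric \<Rightarrow> ('a \<Rightarrow> 'b) \<Rightarrow> bool" where
  "coarse_map X Y f \<longleftrightarrow>
     f ` mspace X \<subseteq> mspace Y \<and>
     (\<forall>E. entourage X E \<longrightarrow> entourage Y (map_prod f f ` E)) \<and>
     (\<forall>B. bounded_in Y B \<longrightarrow> bounded_in X (f -` B \<inter> mspace X))"

definition close_maps :: "'a metric \<Rightarrow> 'b metric \<Rightarrow> ('a \<Rightarrow> 'b) \<Rightarrow> ('a \<Rightarrow> 'b) \<Rightarrow> bool" where
  "close_maps X Y f g \<longleftrightarrow> bdd_above ((\<lambda>x. mdist Y (f x) (g x)) ` mspace X)"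


section \<open>The category of metric spaces and coarse maps modulo closeness\<close>

text \<open>
  A map on \<open>mspace X\<close> is represented by total functions. Functions that agree on \<open>mspace X\<close> are
  close, so the quotient by closeness also removes the dependence on values outside \<open>mspace X\<close>.
\<close>

definition closeness :: "'a metric \<Rightarrow> 'b metric \<Rightarrow> (('a \<Rightarrow> 'b) \<times> ('a \<Rightarrow> 'b)) set" where
  "closeness X Y = {(f, g). coarse_map X Y f \<and> coarse_map X Y g \<and> close_maps X Y f g}"

definition coarse_hom :: "'a metric \<Rightarrow> 'b metric \<Rightarrow> ('a \<Rightarrow> 'b) set set" where
  "coarse_hom X Y = Collect (coarse_map X Y) // closeness X Y"

definition coarse_comp ::
  "'a metric \<Rightarrow> 'c metric \<Rightarrow> ('b \<Rightarrow> 'c) set \<Rightarrow> ('a \<Rightarrow> 'b) set \<Rightarrow> ('a \<Rightarrow> 'c) set" where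
  "coarse_comp X Z G F = (\<Union>g\<in>G. \<Union>f\<in>F. closeness X Z `` {g \<circ> f})"

definition coarse_category :: "('a metric, ('a \<Rightarrow> 'a) set) cat" where
  "coarse_category =
     \<lparr>Obj = UNIV,
      Hom = coarse_hom,
      Comp = (\<lambda>X Y Z. coarse_comp X Z),
      Ident = (\<lambda>X. closeness X X `` {id})\<rparr>"

text \<open>
  \<open>coarse_category\<close> at type \<open>'a\<close> comprises the metric spaces whose underlying set is a set of
  elements of \<open>'a\<close>. The following predicates express the universal property of a cocone in this
  category with respect to metric spaces over another type \<open>'b\<close>, so that colimits need not be
  tested against metric spaces of bounded cardinality only. For \<open>'b = 'a\<close> they specialise to
  \<open>is_cocone\<close> and the universal property in \<open>is_colimit\<close>.
\<close>

definition coarse_cocone ::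
  "('j, 'k) cat \<Rightarrow> ('j \<Rightarrow> 'a metric) \<Rightarrow> ('j \<Rightarrow> 'j \<Rightarrow> 'k \<Rightarrow> ('a \<Rightarrow> 'a) set) \<Rightarrow>
    'b metric \<Rightarrow> ('j \<Rightarrow> ('a \<Rightarrow> 'b) set) \<Rightarrow> bool" where
  "coarse_cocone \<J> F\<^sub>O F\<^sub>M Z \<phi> \<longleftrightarrow>
     (\<forall>i\<in>Obj \<J>. \<phi> i \<in> coarse_hom (F\<^sub>O i) Z) \<and>
     (\<forall>i\<in>Obj \<J>. \<forall>j\<in>Obj \<J>. \<forall>u\<in>Hom \<J> i j.
        coarse_comp (F\<^sub>O i) Z (\<phi> j) (F\<^sub>M i j u) = \<phi> i)"

definition coarse_universal ::
  "('j, 'k) cat \<Rightarrow> ('j \<Rightarrow> 'a metric) \<Rightarrow> ('j \<Rightarrow> 'j \<Rightarrow> 'k \<Rightarrow> ('a \<Rightarrow> 'a) set) \<Rightarrow>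
    'a metric \<Rightarrow> ('j \<Rightarrow> ('a \<Rightarrow> 'a) set) \<Rightarrow> 'b itself \<Rightarrow> bool" where
  "coarse_universal \<J> F\<^sub>O F\<^sub>M V \<iota> (_ :: 'b itself) \<longleftrightarrow>
     (\<forall>(Z :: 'b metric) \<phi>. coarse_cocone \<J> F\<^sub>O F\<^sub>M Z \<phi> \<longrightarrow>
        (\<exists>!h. h \<in> coarse_hom V Z \<and> (\<forall>i\<in>Obj \<J>. coarse_comp (F\<^sub>O i) Z h (\<iota> i) = \<phi> i)))"

end

theory Submission
  imports Defs
begin

text \<open>
  Let \<open>X\<close> be a finite diagram of metric spaces, with a coarse map chosen to represent each arrow.
  The colimit can be written down at once: take the disjoint union of the spaces \<open>X i\<close>, and put on
  it the path metric of a weighted graph. Two points of the same space are joined by an edge whose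
  weight is their distance rounded up, every point \<open>x\<close> of \<open>X i\<close> is joined to its image under every
  arrow out of \<open>i\<close>, and the basepoints of the nonempty spaces are joined to each other, so that all
  distances are finite. A map out of this space is controlled as soon as it is controlled on edges
  (\<open>bornologous_graph_metric\<close>). Of a map assembled from a cocone this asks that every leg be
  controlled, that the triangles of the cocone commute up to closeness, and that finitely many
  distances between images of basepoints be finite; so cocones extend.

  Gluing might create new bounded sets and so destroy properness of the inclusions
  \<open>X i \<rightarrow> glued\<close>. That it does not is the heart of the proof: a step along an arrow moves a
  set to an image or a preimage under a coarse map, and both operations preserve boundedness.
  As there are only finitely many arrows and a path of bounded length has boundedly many steps of
  bounded weight, a ball of the glued space meets every \<open>X i\<close> in a bounded set
  (\<open>fibrewise_bounded_chain\<close>, \<open>bounded_in_glued_iff\<close>). Properness of the inclusions and of induced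
  maps both follow.

  The glued space lives on \<open>'j \<times> 'a\<close> and has the universal property for metric spaces over every
  type. Colimits are invariant under coarse equivalence (\<open>map_universal_transport\<close>), and this is
  used twice. It brings the glued space into type \<open>'a\<close>: if \<open>'a\<close> is infinite, finitely many copies
  of \<open>'a\<close> inject into \<open>'a\<close>; if \<open>'a\<close> is finite, the glued space is finite, hence bounded and coarsely
  a point or empty. It also shows that an arbitrary colimit among spaces over \<open>'a\<close>, being
  isomorphic to the one constructed, inherits the universal property for spaces over \<open>'b\<close>.

  All of this is phrased for representing maps and closeness;
  \<open>coarse_universal_iff_map_universal\<close> translates it into statements about closeness classes.
\<close>

section \<open>Coarse maps and closeness\<close>

lemma mdist_self: "x \<in> mspace X \<Longrightarrow> mdist X x x = 0"
  by simp

lemma entourage_iff: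
  "entourage X E \<longleftrightarrow>
     E \<subseteq> mspace X \<times> mspace X \<and> (\<exists>C. \<forall>x y. (x, y) \<in> E \<longrightarrow> mdist X x y \<le> C)"
  unfolding entourage_def bdd_above_def by fastforce

lemma bounded_in_iff:
  "bounded_in X B \<longleftrightarrow> B \<subseteq> mspace X \<and> (\<exists>C. \<forall>x\<in>B. \<forall>y\<in>B. mdist X x y \<le> C)"
  unfolding bounded_in_def by (rule Metric_space.mbounded_alt) simp

lemma bounded_in_subset: "bounded_in X B \<Longrightarrow> A \<subseteq> B \<Longrightarrow> bounded_in X A"
  unfolding bounded_in_def by (rule Metric_space.mbounded_subset) auto

lemma bounded_in_Un: "bounded_in X A \<Longrightarrow> bounded_in X B \<Longrightarrow> bounded_in X (A \<union> B)"
  unfolding bounded_in_def by (simp add: Metric_space.mbounded_Un)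

lemma bounded_in_UN:
  "finite I \<Longrightarrow> (\<And>i. i \<in> I \<Longrightarrow> bounded_in X (B i)) \<Longrightarrow> bounded_in X (\<Union>i\<in>I. B i)"
  unfolding bounded_in_def by (rule Metric_space.mbounded_Union) auto

lemma bounded_in_singleton: "x \<in> mspace X \<Longrightarrow> bounded_in X {x}"
  by (auto simp: bounded_in_iff)

lemma finite_imp_bounded_in:
  assumes "finite B" "B \<subseteq> mspace X"
  shows "bounded_in X B"
  using bounded_in_UN[OF assms(1), of X "\<lambda>x. {x}"] assms(2)
  by (auto intro: bounded_in_singleton)

lemma bounded_in_neighbourhood:
  assumes "bounded_in X B"
  shows "bounded_in X {y \<in> mspace X. \<exists>x\<in>B. mdist X x y \<le> R}"
proof -
  obtain C where C: "\<And>x y. x \<in> B \<Longrightarrow> y \<in> B \<Longrightarrow> mdist X x y \<le> C" and B: "B \<subseteq> mspace X"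
    using assms by (auto simp: bounded_in_iff)
  have "mdist X y y' \<le> R + C + R"
    if "y \<in> mspace X" "y' \<in> mspace X" "x \<in> B" "x' \<in> B" "mdist X x y \<le> R" "mdist X x' y' \<le> R"
    for y y' x x'
  proof -
    have "x \<in> mspace X" "x' \<in> mspace X" using that B by auto
    then show ?thesis
      using that C[of x x'] mdist_triangle[of y X x y'] mdist_triangle[of x X x' y']
        mdist_commute[of X x y] by fastforce
  qed
  then show ?thesis unfolding bounded_in_iff by fast
qed

text \<open>
  The half of coarseness that says that entourages go to entourages, stated with the control
  function \<open>R \<mapsto> C\<close>. The other half, properness, often has to be proved by a different argument.
\<close>

definition bornologous :: "'a metric \<Rightarrow> 'b metric \<Rightarrow> ('a \<Rightarrow> 'b) \<Rightarrow> bool" where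
  "bornologous X Y f \<longleftrightarrow>
     f ` mspace X \<subseteq> mspace Y \<and>
     (\<forall>R. \<exists>C. \<forall>x\<in>mspace X. \<forall>y\<in>mspace X. mdist X x y \<le> R \<longrightarrow> mdist Y (f x) (f y) \<le> C)"

lemma bornologousD:
  assumes "bornologous X Y f"
  shows "\<exists>C. \<forall>x\<in>mspace X. \<forall>y\<in>mspace X. mdist X x y \<le> R \<longrightarrow> mdist Y (f x) (f y) \<le> C"
  using assms unfolding bornologous_def by blast

lemma coarse_map_iff:
  "coarse_map X Y f \<longleftrightarrow>
     bornologous X Y f \<and> (\<forall>B. bounded_in Y B \<longrightarrow> bounded_in X (f -` B \<inter> mspace X))"
proof -
  have "bornologous X Y f \<longleftrightarrow>
    f ` mspace X \<subseteq> mspace Y \<and> (\<forall>E. entourage X E \<longrightarrow> entourage Y (map_prod f f ` E))"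
    (is "_ \<longleftrightarrow> ?into \<and> ?ent")
  proof (intro iffI conjI allI impI)
    assume b: "bornologous X Y f"
    then show ?into by (simp add: bornologous_def)
    fix E assume "entourage X E"
    then obtain R where E: "E \<subseteq> mspace X \<times> mspace X" "\<And>x y. (x, y) \<in> E \<Longrightarrow> mdist X x y \<le> R"
      by (auto simp: entourage_iff)
    obtain C where C: "\<forall>x\<in>mspace X. \<forall>y\<in>mspace X. mdist X x y \<le> R \<longrightarrow> mdist Y (f x) (f y) \<le> C"
      using bornologousD[OF b, of R] ..
    show "entourage Y (map_prod f f ` E)"
      unfolding entourage_iff using E C \<open>?into\<close> by (force intro!: exI[of _ C])
  next
    assume a: "?into \<and> ?ent"
    have "\<exists>C. \<forall>x\<in>mspace X. \<forall>y\<in>mspace X. mdist X x y \<le> R \<longrightarrow> mdist Y (f x) (f y) \<le> C" for R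
    proof -
      define E where "E = {(x, y). x \<in> mspace X \<and> y \<in> mspace X \<and> mdist X x y \<le> R}"
      have "entourage X E" by (auto simp: entourage_iff E_def)
      then have "entourage Y (map_prod f f ` E)" using a by blast
      then obtain C where C: "\<forall>p q. (p, q) \<in> map_prod f f ` E \<longrightarrow> mdist Y p q \<le> C"
        unfolding entourage_iff by blast
      have "mdist Y (f x) (f y) \<le> C" if "x \<in> mspace X" "y \<in> mspace X" "mdist X x y \<le> R" for x y
        using that C by (auto simp: E_def intro!: C[rule_format] rev_image_eqI[of "(x, y)"])
      then show ?thesis by blast
    qed
    then show "bornologous X Y f" using a by (simp add: bornologous_def)
  qed
  then show ?thesis unfolding coarse_map_def by blast
qed

lemma coarse_map_into: "coarse_map X Y f \<Longrightarrow> x \<in> mspace X \<Longrightarrow> f x \<in> mspace Y"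
  unfolding coarse_map_def by blast

lemma coarse_map_bound:
  assumes "coarse_map X Y f"
  shows "\<exists>C. \<forall>x\<in>mspace X. \<forall>y\<in>mspace X. mdist X x y \<le> R \<longrightarrow> mdist Y (f x) (f y) \<le> C"
  using assms bornologousD unfolding coarse_map_iff by blast

lemma coarse_map_vimage:
  "coarse_map X Y f \<Longrightarrow> bounded_in Y B \<Longrightarrow> bounded_in X (f -` B \<inter> mspace X)"
  unfolding coarse_map_def by blast

lemma bounded_in_image:
  assumes "bornologous X Y f" "bounded_in X B"
  shows "bounded_in Y (f ` B)"
proof -
  obtain R where R: "B \<subseteq> mspace X" "\<And>x y. x \<in> B \<Longrightarrow> y \<in> B \<Longrightarrow> mdist X x y \<le> R"
    using assms(2) by (auto simp: bounded_in_iff)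
  obtain C where "\<forall>x\<in>mspace X. \<forall>y\<in>mspace X. mdist X x y \<le> R \<longrightarrow> mdist Y (f x) (f y) \<le> C"
    using bornologousD[OF assms(1), of R] ..
  then have "\<forall>p\<in>f ` B. \<forall>q\<in>f ` B. mdist Y p q \<le> C" using R by blast
  moreover have "f ` B \<subseteq> mspace Y" using R(1) assms(1) by (auto simp: bornologous_def)
  ultimately show ?thesis unfolding bounded_in_iff by blast
qed

lemma coarse_map_id: "coarse_map X X id"
proof -
  have "bornologous X X id" unfolding bornologous_def by auto
  then show ?thesis unfolding coarse_map_iff by (auto intro: bounded_in_subset)
qed

lemma coarse_map_comp:
  assumes f: "coarse_map X Y f" and g: "coarse_map Y Z g"
  shows "coarse_map X Z (g \<circ> f)"
proof -
  have "\<exists>C. \<forall>x\<in>mspace X. \<forall>y\<in>mspace X. mdist X x y \<le> R \<longrightarrow> mdist Z ((g \<circ> f) x) ((g \<circ> f) y) \<le> C" for R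
  proof -
    obtain C where C: "\<forall>x\<in>mspace X. \<forall>y\<in>mspace X. mdist X x y \<le> R \<longrightarrow> mdist Y (f x) (f y) \<le> C"
      using coarse_map_bound[OF f, of R] ..
    obtain D where D: "\<forall>x\<in>mspace Y. \<forall>y\<in>mspace Y. mdist Y x y \<le> C \<longrightarrow> mdist Z (g x) (g y) \<le> D"
      using coarse_map_bound[OF g, of C] ..
    show ?thesis
      using C D coarse_map_into[OF f] by (intro exI[of _ D]) auto
  qed
  moreover have "bounded_in X ((g \<circ> f) -` B \<inter> mspace X)" if "bounded_in Z B" for B
    by (rule bounded_in_subset[OF coarse_map_vimage[OF f coarse_map_vimage[OF g that]]])
      (use coarse_map_into[OF f] in auto)
  ultimately show ?thesis
    unfolding coarse_map_iff bornologous_def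
    using coarse_map_into[OF f] coarse_map_into[OF g] by auto
qed

text \<open>
  An additive distortion bound controls distances in both directions: the upper bound makes the
  map bornologous, and the lower bound makes it proper.
\<close>

lemma rough_isometric_embedding_imp_coarse:
  assumes into: "f ` mspace X \<subseteq> mspace Y"
    and K: "\<And>x y. x \<in> mspace X \<Longrightarrow> y \<in> mspace X \<Longrightarrow> \<bar>mdist Y (f x) (f y) - mdist X x y\<bar> \<le> K"
  shows "coarse_map X Y f"
proof -
  have "\<exists>C. \<forall>x\<in>mspace X. \<forall>y\<in>mspace X. mdist X x y \<le> R \<longrightarrow> mdist Y (f x) (f y) \<le> C" for R
    using K by (intro exI[of _ "R + K"]) (smt (verit))
  moreover have "bounded_in X (f -` B \<inter> mspace X)" if "bounded_in Y B" for B
  proof -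
    obtain C where "\<And>x y. x \<in> B \<Longrightarrow> y \<in> B \<Longrightarrow> mdist Y x y \<le> C"
      using \<open>bounded_in Y B\<close> by (auto simp: bounded_in_iff)
    then have "mdist X x y \<le> C + K" if "x \<in> f -` B \<inter> mspace X" "y \<in> f -` B \<inter> mspace X" for x y
      using K[of x y] that by fastforce
    then show ?thesis unfolding bounded_in_iff by blast
  qed
  ultimately show ?thesis using into unfolding coarse_map_iff bornologous_def by auto
qed

lemma close_maps_iff:
  "close_maps X Y f g \<longleftrightarrow> (\<exists>C. \<forall>x\<in>mspace X. mdist Y (f x) (g x) \<le> C)"
  unfolding close_maps_def bdd_above_def by auto

lemma close_maps_sym: "close_maps X Y f g \<Longrightarrow> close_maps X Y g f"
  by (simp add: close_maps_def mdist_commute)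

lemma close_maps_trans:
  assumes "coarse_map X Y f" "coarse_map X Y g" "coarse_map X Y h"
    and "close_maps X Y f g" "close_maps X Y g h"
  shows "close_maps X Y f h"
proof -
  obtain C D where "\<And>x. x \<in> mspace X \<Longrightarrow> mdist Y (f x) (g x) \<le> C"
      "\<And>x. x \<in> mspace X \<Longrightarrow> mdist Y (g x) (h x) \<le> D"
    using assms(4,5) by (auto simp: close_maps_iff)
  then have "mdist Y (f x) (h x) \<le> C + D" if "x \<in> mspace X" for x
    using mdist_triangle[of "f x" Y "g x" "h x"] assms(1-3)[THEN coarse_map_into, OF that] that
    by fastforce
  then show ?thesis unfolding close_maps_iff by blast
qed

lemma close_maps_refl: "coarse_map X Y f \<Longrightarrow> close_maps X Y f f"
  unfolding close_maps_iff by (intro exI[of _ 0] ballI) (simp add: mdist_self coarse_map_into)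

lemma close_maps_comp_left:
  assumes f: "coarse_map X Y f" "coarse_map X Y f'" "close_maps X Y f f'" and g: "coarse_map Y Z g"
  shows "close_maps X Z (g \<circ> f) (g \<circ> f')"
proof -
  obtain R where R: "\<And>x. x \<in> mspace X \<Longrightarrow> mdist Y (f x) (f' x) \<le> R"
    using f(3) by (auto simp: close_maps_iff)
  obtain C where "\<forall>x\<in>mspace Y. \<forall>y\<in>mspace Y. mdist Y x y \<le> R \<longrightarrow> mdist Z (g x) (g y) \<le> C"
    using coarse_map_bound[OF g, of R] ..
  then have "\<forall>x\<in>mspace X. mdist Z (g (f x)) (g (f' x)) \<le> C"
    using R f(1,2)[THEN coarse_map_into] by blast
  then show ?thesis by (auto simp: close_maps_iff)
qed

lemma close_maps_comp_right:
  assumes "coarse_map X Y f" "close_maps Y Z g g'"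
  shows "close_maps X Z (g \<circ> f) (g' \<circ> f)"
  using assms coarse_map_into by (fastforce simp: close_maps_iff)


section \<open>Morphisms as closeness classes\<close>

abbreviation closeness_class :: "'a metric \<Rightarrow> 'b metric \<Rightarrow> ('a \<Rightarrow> 'b) \<Rightarrow> ('a \<Rightarrow> 'b) set" where
  "closeness_class X Y f \<equiv> closeness X Y `` {f}"

lemma equiv_closeness: "equiv (Collect (coarse_map X Y)) (closeness X Y)"
proof (rule equivI)
  show "closeness X Y \<subseteq> Collect (coarse_map X Y) \<times> Collect (coarse_map X Y)"
    by (auto simp: closeness_def)
  show "refl_on (Collect (coarse_map X Y)) (closeness X Y)"
    by (auto simp: closeness_def refl_on_def close_maps_refl)
  show "sym (closeness X Y)"
    by (auto simp: closeness_def sym_def close_maps_sym)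
  show "trans (closeness X Y)"
    unfolding closeness_def trans_def using close_maps_trans by fast
qed

lemma coarse_hom_iff:
  "F \<in> coarse_hom X Y \<longleftrightarrow> (\<exists>f. coarse_map X Y f \<and> F = closeness_class X Y f)"
  unfolding coarse_hom_def quotient_def by auto

lemma coarse_homE:
  assumes "F \<in> coarse_hom X Y"
  obtains f where "coarse_map X Y f" "F = closeness_class X Y f"
  using assms unfolding coarse_hom_iff by blast

lemma closeness_class_in_coarse_hom: "coarse_map X Y f \<Longrightarrow> closeness_class X Y f \<in> coarse_hom X Y"
  unfolding coarse_hom_iff by blast

lemma closeness_class_eq_iff:
  assumes "coarse_map X Y f" "coarse_map X Y g"
  shows "closeness_class X Y f = closeness_class X Y g \<longleftrightarrow> close_maps X Y f g"
  using eq_equiv_class_iff[OF equiv_closeness, of f X Y g] assms by (simp add: closeness_def)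

text \<open>
  The union in the definition of composition is over all representatives. Composition respects
  closeness, so all members of the union are one and the same class.
\<close>

lemma coarse_comp_closeness_class:
  assumes f: "coarse_map X Y f" and g: "coarse_map Y Z g"
  shows "coarse_comp X Z (closeness_class Y Z g) (closeness_class X Y f) = closeness_class X Z (g \<circ> f)"
proof -
  have "closeness_class X Z (g' \<circ> f') = closeness_class X Z (g \<circ> f)"
    if "g' \<in> closeness_class Y Z g" "f' \<in> closeness_class X Y f" for g' f'
  proof -
    have f': "coarse_map X Y f'" "close_maps X Y f f'" and g': "coarse_map Y Z g'" "close_maps Y Z g g'"
      using that by (auto simp: closeness_def)
    have "close_maps X Z (g' \<circ> f') (g \<circ> f')"
      using close_maps_comp_right[OF f'(1) g'(2)] by (rule close_maps_sym)
    moreover have "close_maps X Z (g \<circ> f') (g \<circ> f)"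
      using close_maps_comp_left[OF f f' g] by (rule close_maps_sym)
    ultimately have "close_maps X Z (g' \<circ> f') (g \<circ> f)"
      using f g f' g' by (meson close_maps_trans coarse_map_comp)
    then show ?thesis
      using f g f' g' by (simp add: closeness_class_eq_iff coarse_map_comp)
  qed
  moreover have "g \<in> closeness_class Y Z g" "f \<in> closeness_class X Y f"
    using f g by (auto simp: closeness_def close_maps_refl)
  ultimately show ?thesis unfolding coarse_comp_def by blast
qed

lemma is_category_coarse_category: "is_category (coarse_category :: ('a metric, ('a \<Rightarrow> 'a) set) cat)"
  unfolding is_category_def coarse_category_def
  by (auto elim!: coarse_homE simp: coarse_comp_closeness_class coarse_map_id coarse_map_comp comp_assoc
      intro!: closeness_class_in_coarse_hom)


section \<open>Cocones and colimits in terms of representatives\<close>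

text \<open>
  Below, \<open>I\<close> is the set of objects of the shape, \<open>A i j\<close> is its set of arrows from \<open>i\<close> to \<open>j\<close>, and
  \<open>f i j u\<close> represents the image of the arrow \<open>u\<close>. The cocone condition is one closeness
  relation per arrow, so the data are those of a diagram over a graph.
\<close>

definition map_cocone ::
  "'j set \<Rightarrow> ('j \<Rightarrow> 'j \<Rightarrow> 'k set) \<Rightarrow> ('j \<Rightarrow> 'a metric) \<Rightarrow> ('j \<Rightarrow> 'j \<Rightarrow> 'k \<Rightarrow> 'a \<Rightarrow> 'a) \<Rightarrow>
    'b metric \<Rightarrow> ('j \<Rightarrow> 'a \<Rightarrow> 'b) \<Rightarrow> bool" where
  "map_cocone I A X f Z \<phi> \<longleftrightarrow>
     (\<forall>i\<in>I. coarse_map (X i) Z (\<phi> i)) \<and>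
     (\<forall>i\<in>I. \<forall>j\<in>I. \<forall>u\<in>A i j. close_maps (X i) Z (\<phi> j \<circ> f i j u) (\<phi> i))"

definition factors_through ::
  "'j set \<Rightarrow> ('j \<Rightarrow> 'a metric) \<Rightarrow> 'v metric \<Rightarrow> ('j \<Rightarrow> 'a \<Rightarrow> 'v) \<Rightarrow>
    'b metric \<Rightarrow> ('j \<Rightarrow> 'a \<Rightarrow> 'b) \<Rightarrow> ('v \<Rightarrow> 'b) \<Rightarrow> bool" where
  "factors_through I X V \<iota> Z \<phi> h \<longleftrightarrow>
     coarse_map V Z h \<and> (\<forall>i\<in>I. close_maps (X i) Z (h \<circ> \<iota> i) (\<phi> i))"

text \<open>
  The universal property is restricted to test spaces over one type \<open>'b\<close>, which is therefore a
  parameter and may differ from the type of the points of \<open>V\<close>.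
\<close>

definition map_universal ::
  "'j set \<Rightarrow> ('j \<Rightarrow> 'j \<Rightarrow> 'k set) \<Rightarrow> ('j \<Rightarrow> 'a metric) \<Rightarrow> ('j \<Rightarrow> 'j \<Rightarrow> 'k \<Rightarrow> 'a \<Rightarrow> 'a) \<Rightarrow>
    'v metric \<Rightarrow> ('j \<Rightarrow> 'a \<Rightarrow> 'v) \<Rightarrow> 'b itself \<Rightarrow> bool" where
  "map_universal I A X f V \<iota> (_ :: 'b itself) \<longleftrightarrow>
     (\<forall>(Z :: 'b metric) \<phi>. map_cocone I A X f Z \<phi> \<longrightarrow>
        (\<exists>h. factors_through I X V \<iota> Z \<phi> h) \<and>
        (\<forall>h h'. factors_through I X V \<iota> Z \<phi> h \<longrightarrow> factors_through I X V \<iota> Z \<phi> h' \<longrightarrow>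
           close_maps V Z h h'))"

lemma map_coconeD:
  assumes "map_cocone I A X f Z \<phi>"
  shows "i \<in> I \<Longrightarrow> coarse_map (X i) Z (\<phi> i)"
    and "i \<in> I \<Longrightarrow> j \<in> I \<Longrightarrow> u \<in> A i j \<Longrightarrow> close_maps (X i) Z (\<phi> j \<circ> f i j u) (\<phi> i)"
  using assms by (auto simp: map_cocone_def)

lemma factors_throughD:
  assumes "factors_through I X V \<iota> Z \<phi> h"
  shows "coarse_map V Z h" and "i \<in> I \<Longrightarrow> close_maps (X i) Z (h \<circ> \<iota> i) (\<phi> i)"
  using assms by (auto simp: factors_through_def)

lemma map_universal_exists:
  "map_universal I A X f V \<iota> TYPE('b) \<Longrightarrow> map_cocone I A X f (Z :: 'b metric) \<phi> \<Longrightarrow>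
     \<exists>h. factors_through I X V \<iota> Z \<phi> h"
  by (simp add: map_universal_def)

lemma map_universal_unique:
  "map_universal I A X f V \<iota> TYPE('b) \<Longrightarrow> map_cocone I A X f (Z :: 'b metric) \<phi> \<Longrightarrow>
     factors_through I X V \<iota> Z \<phi> h \<Longrightarrow> factors_through I X V \<iota> Z \<phi> h' \<Longrightarrow> close_maps V Z h h'"
  by (simp add: map_universal_def)

lemma factors_through_id:
  "map_cocone I A X f V \<iota> \<Longrightarrow> factors_through I X V \<iota> V \<iota> id"
  by (auto simp: factors_through_def map_cocone_def coarse_map_id close_maps_refl)

lemma factors_through_comp:
  assumes i: "\<And>i. i \<in> I \<Longrightarrow> coarse_map (X i) V (\<iota> i)"
    and i': "\<And>i. i \<in> I \<Longrightarrow> coarse_map (X i) W (\<iota>' i)"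
    and p: "\<And>i. i \<in> I \<Longrightarrow> coarse_map (X i) Z (\<phi> i)"
    and s: "factors_through I X V \<iota> W \<iota>' s" and h: "factors_through I X W \<iota>' Z \<phi> h"
  shows "factors_through I X V \<iota> Z \<phi> (h \<circ> s)"
  unfolding factors_through_def
proof (intro conjI ballI)
  note s' = factors_throughD[OF s] and h' = factors_throughD[OF h]
  show "coarse_map V Z (h \<circ> s)" by (rule coarse_map_comp[OF s'(1) h'(1)])
  fix j assume j: "j \<in> I"
  have "close_maps (X j) Z (h \<circ> (s \<circ> \<iota> j)) (h \<circ> \<iota>' j)"
    using close_maps_comp_left[OF coarse_map_comp[OF i[OF j] s'(1)] i'[OF j] s'(2)[OF j] h'(1)] .
  then show "close_maps (X j) Z (h \<circ> s \<circ> \<iota> j) (\<phi> j)"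
    unfolding comp_assoc
    using h'(2)[OF j]
    by (rule close_maps_trans[rotated 3])
      (use coarse_map_comp[OF i[OF j] s'(1)] coarse_map_comp[OF i'[OF j] h'(1)] p[OF j] h'(1)
        in \<open>auto intro: coarse_map_comp\<close>)
qed

lemma map_cocone_transport:
  assumes d: "\<And>i j u. i \<in> I \<Longrightarrow> j \<in> I \<Longrightarrow> u \<in> A i j \<Longrightarrow> coarse_map (X i) (X j) (f i j u)"
    and c: "map_cocone I A X f V \<iota>" and s: "coarse_map V W s"
  shows "map_cocone I A X f W (\<lambda>i. s \<circ> \<iota> i)"
  unfolding map_cocone_def
proof (intro conjI ballI)
  fix i assume i: "i \<in> I"
  show "coarse_map (X i) W (s \<circ> \<iota> i)" using map_coconeD(1)[OF c i] s by (rule coarse_map_comp)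
  fix j u assume j: "j \<in> I" and u: "u \<in> A i j"
  show "close_maps (X i) W (s \<circ> \<iota> j \<circ> f i j u) (s \<circ> \<iota> i)"
    unfolding comp_assoc
    using coarse_map_comp[OF d[OF i j u] map_coconeD(1)[OF c j]] map_coconeD(1)[OF c i]
      map_coconeD(2)[OF c i j u] s
    by (rule close_maps_comp_left)
qed

text \<open>
  Precomposition with the two halves \<open>s\<close> and \<open>t\<close> of a coarse equivalence turns factorisations
  through \<open>W\<close> into factorisations through \<open>V\<close> and back, and the two passages are mutually inverse up
  to closeness. The legs \<open>\<iota>' i\<close> need only be close to \<open>s \<circ> \<iota> i\<close>, so that the lemma also covers a
  comparison of two colimits that were given independently of each other.
\<close>

lemma map_universal_transport:
  fixes V :: "'v metric" and W :: "'w metric"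
  assumes i: "\<And>i. i \<in> I \<Longrightarrow> coarse_map (X i) V (\<iota> i)"
    and i': "\<And>i. i \<in> I \<Longrightarrow> coarse_map (X i) W (\<iota>' i)"
    and s: "factors_through I X V \<iota> W \<iota>' s" and t: "coarse_map W V t"
    and ts: "close_maps V V (t \<circ> s) id" and st: "close_maps W W (s \<circ> t) id"
    and u: "map_universal I A X f V \<iota> TYPE('b)"
  shows "map_universal I A X f W \<iota>' TYPE('b)"
  unfolding map_universal_def
proof (intro allI impI conjI)
  note s' = factors_throughD[OF s]
  have tfac: "factors_through I X W \<iota>' V \<iota> t"
    unfolding factors_through_def
  proof (intro conjI ballI t)
    fix j assume j: "j \<in> I"
    have "close_maps (X j) V (t \<circ> \<iota>' j) (t \<circ> (s \<circ> \<iota> j))"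
      using i'[OF j] coarse_map_comp[OF i[OF j] s'(1)] close_maps_sym[OF s'(2)[OF j]] t
      by (rule close_maps_comp_left)
    moreover have "close_maps (X j) V ((t \<circ> s) \<circ> \<iota> j) (id \<circ> \<iota> j)"
      by (rule close_maps_comp_right[OF i[OF j] ts])
    ultimately show "close_maps (X j) V (t \<circ> \<iota>' j) (\<iota> j)"
      unfolding comp_assoc id_comp
      by (rule close_maps_trans[OF coarse_map_comp[OF i'[OF j] t]
            coarse_map_comp[OF coarse_map_comp[OF i[OF j] s'(1)] t] i[OF j]])
  qed
  fix Z :: "'b metric" and \<phi>
  assume c: "map_cocone I A X f Z \<phi>"
  obtain h where "factors_through I X V \<iota> Z \<phi> h" using map_universal_exists[OF u c] ..
  then show "\<exists>h. factors_through I X W \<iota>' Z \<phi> h"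
    using factors_through_comp[OF i' i map_coconeD(1)[OF c] tfac] by blast
  fix h h' assume h: "factors_through I X W \<iota>' Z \<phi> h" "factors_through I X W \<iota>' Z \<phi> h'"
  note hc = h[THEN factors_throughD(1)]
  have "close_maps V Z (h \<circ> s) (h' \<circ> s)"
    using factors_through_comp[OF i i' map_coconeD(1)[OF c] s] h
    by (blast intro: map_universal_unique[OF u c])
  then have "close_maps W Z ((h \<circ> s) \<circ> t) ((h' \<circ> s) \<circ> t)"
    by (rule close_maps_comp_right[OF t])
  then have m: "close_maps W Z (h \<circ> (s \<circ> t)) (h' \<circ> (s \<circ> t))"
    by (simp add: comp_assoc)
  have st': "coarse_map W W (s \<circ> t)" by (rule coarse_map_comp[OF t s'(1)])
  have e: "close_maps W Z (g \<circ> (s \<circ> t)) g" if "coarse_map W Z g" for g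
    using close_maps_comp_left[OF st' coarse_map_id st that] by simp
  have "close_maps W Z h (h' \<circ> (s \<circ> t))"
    using close_maps_sym[OF e[OF hc(1)]] m
    by (rule close_maps_trans[rotated 3]) (auto intro: coarse_map_comp[OF st'] hc)
  then show "close_maps W Z h h'"
    using e[OF hc(2)]
    by (rule close_maps_trans[rotated 3]) (auto intro: coarse_map_comp[OF st'] hc)
qed

text \<open>
  Two cocones \<open>V\<close> and \<open>W\<close> that are universal among spaces over their own type are isomorphic by the
  usual argument. Whatever \<open>V\<close> satisfies for test spaces over another type then passes to \<open>W\<close>.
\<close>

lemma map_universal_change_test_type:
  fixes V W :: "'v metric"
  assumes cV: "map_cocone I A X f V \<iota>" and uV: "map_universal I A X f V \<iota> TYPE('v)"
    and uV': "map_universal I A X f V \<iota> TYPE('b)"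
    and cW: "map_cocone I A X f W \<iota>'" and uW: "map_universal I A X f W \<iota>' TYPE('v)"
  shows "map_universal I A X f W \<iota>' TYPE('b)"
proof -
  obtain s where s: "factors_through I X V \<iota> W \<iota>' s" using map_universal_exists[OF uV cW] ..
  obtain t where t: "factors_through I X W \<iota>' V \<iota> t" using map_universal_exists[OF uW cV] ..
  note iV = map_coconeD(1)[OF cV] and iW = map_coconeD(1)[OF cW]
  have "close_maps V V (t \<circ> s) id"
    using map_universal_unique[OF uV cV factors_through_comp[OF iV iW iV s t] factors_through_id[OF cV]] .
  moreover have "close_maps W W (s \<circ> t) id"
    using map_universal_unique[OF uW cW factors_through_comp[OF iW iV iW t s] factors_through_id[OF cW]] .
  ultimately show ?thesis
    using map_universal_transport[OF iV iW s factors_throughD(1)[OF t] _ _ uV'] by blast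
qed


section \<open>The path metric of a weighted graph\<close>

text \<open>
  \<open>e w p q\<close> is meant as: there is an edge of weight at most \<open>w\<close> from \<open>p\<close> to \<open>q\<close>. Such a step costs
  \<open>w + 1\<close>, so that distinct points have distance at least 1 and a chain of length \<open>n\<close> has at most \<open>n\<close>
  steps. Coarse geometry does not see the rounding, and integral lengths let the infimum over
  chains be attained.
\<close>

inductive chain :: "(nat \<Rightarrow> 'v \<Rightarrow> 'v \<Rightarrow> bool) \<Rightarrow> nat \<Rightarrow> 'v \<Rightarrow> 'v \<Rightarrow> bool"
  for e where
  refl: "chain e 0 p p"
| step: "chain e n p q \<Longrightarrow> e w q r \<Longrightarrow> chain e (n + Suc w) p r"

definition chain_dist :: "(nat \<Rightarrow> 'v \<Rightarrow> 'v \<Rightarrow> bool) \<Rightarrow> 'v \<Rightarrow> 'v \<Rightarrow> real" where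
  "chain_dist e p q = real (LEAST n. chain e n p q)"

definition graph_metric :: "'v set \<Rightarrow> (nat \<Rightarrow> 'v \<Rightarrow> 'v \<Rightarrow> bool) \<Rightarrow> 'v metric" where
  "graph_metric S e = metric (S, chain_dist e)"

lemma chain_edge: "e w p q \<Longrightarrow> chain e (Suc w) p q"
  using chain.step[OF chain.refl, of e w p q] by simp

lemma chain_trans: "chain e n q r \<Longrightarrow> chain e m p q \<Longrightarrow> chain e (m + n) p r"
proof (induction rule: chain.induct)
  case (step n q q' w r)
  then show ?case using chain.step[of e "m + n" p q' w r] by (simp add: add.assoc)
qed simp

lemma chain_dist_le: "chain e n p q \<Longrightarrow> chain_dist e p q \<le> real n"
  unfolding chain_dist_def by (simp add: Least_le)

locale weighted_graph =
  fixes S :: "'v set" and e :: "nat \<Rightarrow> 'v \<Rightarrow> 'v \<Rightarrow> bool"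
  assumes edge_sym: "e w p q \<Longrightarrow> e w q p"
    and edge_mono: "e v p q \<Longrightarrow> v \<le> w \<Longrightarrow> e w p q"
    and edge_in: "e w p q \<Longrightarrow> q \<in> S"
    and connected: "p \<in> S \<Longrightarrow> q \<in> S \<Longrightarrow> \<exists>n. chain e n p q"
begin

lemma chain_sym: "chain e n p q \<Longrightarrow> chain e n q p"
proof (induction rule: chain.induct)
  case (refl p) show ?case by (rule chain.refl)
next
  case (step n p q w r)
  show ?case
    using chain_trans[OF step.IH chain_edge[of e, OF edge_sym[OF step.hyps(2)]]]
    by (simp add: add.commute)
qed

lemma chain_of_dist: "p \<in> S \<Longrightarrow> q \<in> S \<Longrightarrow> \<exists>n. chain e n p q \<and> real n = chain_dist e p q"
  unfolding chain_dist_def using LeastI_ex[OF connected] by blast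

lemma Metric_space_chain_dist: "Metric_space S (chain_dist e)"
proof
  show "0 \<le> chain_dist e p q" for p q by (simp add: chain_dist_def)
  show "chain_dist e p q = chain_dist e q p" for p q
    unfolding chain_dist_def by (metis chain_sym)
  show "chain_dist e p q = 0 \<longleftrightarrow> p = q" if pq: "p \<in> S" "q \<in> S" for p q
  proof
    assume "chain_dist e p q = 0"
    then have "chain e 0 p q" using chain_of_dist[OF pq] by auto
    then show "p = q" by (cases rule: chain.cases) auto
  next
    assume "p = q"
    then show "chain_dist e p q = 0"
      using chain_dist_le[OF chain.refl, of e p] by (simp add: chain_dist_def)
  qed
  show "chain_dist e p r \<le> chain_dist e p q + chain_dist e q r"
    if pqr: "p \<in> S" "q \<in> S" "r \<in> S" for p q r
  proof -
    obtain m where m: "chain e m p q" "real m = chain_dist e p q"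
      using chain_of_dist[OF pqr(1,2)] by blast
    obtain n where n: "chain e n q r" "real n = chain_dist e q r"
      using chain_of_dist[OF pqr(2,3)] by blast
    show ?thesis using chain_dist_le[OF chain_trans[OF n(1) m(1)]] m(2) n(2) by simp
  qed
qed

lemma mspace_graph_metric [simp]: "mspace (graph_metric S e) = S"
  and mdist_graph_metric [simp]: "mdist (graph_metric S e) = chain_dist e"
  by (simp_all add: graph_metric_def Metric_space.mspace_metric[OF Metric_space_chain_dist]
      Metric_space.mdist_metric[OF Metric_space_chain_dist])

text \<open>
  A chain of length \<open>n \<le> R\<close> has at most \<open>n\<close> steps, all of weight at most \<open>R\<close>. A bound on the edges
  of that weight therefore adds up, along the chain, to a bound that depends on \<open>R\<close> only.
\<close>

lemma bornologous_graph_metric: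
  assumes into: "h ` S \<subseteq> mspace Z"
    and edges: "\<And>w. \<exists>C. \<forall>p q. e w p q \<longrightarrow> mdist Z (h p) (h q) \<le> C"
  shows "bornologous (graph_metric S e) Z h"
  unfolding bornologous_def
proof (intro conjI allI)
  show "h ` mspace (graph_metric S e) \<subseteq> mspace Z" using into by simp
  fix R :: real
  obtain C where C: "\<forall>p q. e (nat \<lfloor>R\<rfloor>) p q \<longrightarrow> mdist Z (h p) (h q) \<le> C" using edges ..
  have chain: "q \<in> S \<and> mdist Z (h p) (h q) \<le> real n * max C 0"
    if "chain e n p q" "p \<in> S" "n \<le> nat \<lfloor>R\<rfloor>" for n p q
    using that
  proof (induction rule: chain.induct)
    case (refl p)
    then show ?case using into by (simp add: image_subset_iff mdist_self)
  next
    case (step n p q w r)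
    have r: "r \<in> S" using edge_in step.hyps(2) .
    have "e (nat \<lfloor>R\<rfloor>) q r" using edge_mono[OF step.hyps(2)] step.prems by simp
    \<comment> \<open>The last step is charged to its cost \<open>Suc w \<ge> 1\<close>; this needs a nonnegative constant, hence \<open>max C 0\<close>.\<close>
    then have "mdist Z (h q) (h r) \<le> 1 * max C 0" using C by fastforce
    also have "\<dots> \<le> real (Suc w) * max C 0" by (rule mult_right_mono) auto
    finally have "mdist Z (h q) (h r) \<le> real (Suc w) * max C 0" .
    moreover have "q \<in> S" "mdist Z (h p) (h q) \<le> real n * max C 0"
      using step by auto
    moreover have "mdist Z (h p) (h r) \<le> mdist Z (h p) (h q) + mdist Z (h q) (h r)"
      by (rule mdist_triangle) (use into r \<open>q \<in> S\<close> \<open>p \<in> S\<close> in auto)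
    ultimately have "mdist Z (h p) (h r) \<le> real n * max C 0 + real (Suc w) * max C 0" by linarith
    then show ?case using r by (simp add: algebra_simps)
  qed
  have "mdist Z (h p) (h q) \<le> real (nat \<lfloor>R\<rfloor>) * max C 0"
    if pq: "p \<in> S" "q \<in> S" "chain_dist e p q \<le> R" for p q
  proof -
    obtain n where n: "chain e n p q" "real n = chain_dist e p q" using chain_of_dist[OF pq(1,2)] by blast
    then have n': "n \<le> nat \<lfloor>R\<rfloor>" using pq by (simp add: le_nat_floor)
    have "mdist Z (h p) (h q) \<le> real n * max C 0" using chain[OF n(1) pq(1) n'] by simp
    also have "\<dots> \<le> real (nat \<lfloor>R\<rfloor>) * max C 0" using n' by (intro mult_right_mono) auto
    finally show ?thesis .
  qed
  then show "\<exists>C. \<forall>p\<in>mspace (graph_metric S e). \<forall>q\<in>mspace (graph_metric S e).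
      mdist (graph_metric S e) p q \<le> R \<longrightarrow> mdist Z (h p) (h q) \<le> C"
    by auto
qed

end


section \<open>The colimit of a finite diagram as a glued disjoint union\<close>

locale finite_coarse_diagram =
  fixes I :: "'j set" and A :: "'j \<Rightarrow> 'j \<Rightarrow> 'k set"
    and X :: "'j \<Rightarrow> 'a metric" and f :: "'j \<Rightarrow> 'j \<Rightarrow> 'k \<Rightarrow> 'a \<Rightarrow> 'a"
  assumes finite_objects: "finite I"
    and finite_arrows: "i \<in> I \<Longrightarrow> j \<in> I \<Longrightarrow> finite (A i j)"
    and coarse_arrow: "i \<in> I \<Longrightarrow> j \<in> I \<Longrightarrow> u \<in> A i j \<Longrightarrow> coarse_map (X i) (X j) (f i j u)"
begin

definition total :: "('j \<times> 'a) set" where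
  "total = (SIGMA i:I. mspace (X i))"

definition basepoint :: "'j \<Rightarrow> 'a" where
  "basepoint i = (SOME x. x \<in> mspace (X i))"

lemma basepoint_in: "x \<in> mspace (X i) \<Longrightarrow> basepoint i \<in> mspace (X i)"
  unfolding basepoint_def by (rule someI)

text \<open>
  Edges along arrows and between basepoints are given every weight, so the cheapest has weight 0
  and joins points at distance at most 1. The edges \<open>base\<close> make the union of the nonempty spaces
  connected even if the diagram is not.
\<close>

inductive edge :: "nat \<Rightarrow> 'j \<times> 'a \<Rightarrow> 'j \<times> 'a \<Rightarrow> bool" where
  fibre: "i \<in> I \<Longrightarrow> x \<in> mspace (X i) \<Longrightarrow> y \<in> mspace (X i) \<Longrightarrow> mdist (X i) x y \<le> real w \<Longrightarrow>
    edge w (i, x) (i, y)"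
| arrow: "i \<in> I \<Longrightarrow> j \<in> I \<Longrightarrow> u \<in> A i j \<Longrightarrow> x \<in> mspace (X i) \<Longrightarrow> edge w (i, x) (j, f i j u x)"
| arrow_rev: "i \<in> I \<Longrightarrow> j \<in> I \<Longrightarrow> u \<in> A i j \<Longrightarrow> x \<in> mspace (X i) \<Longrightarrow> edge w (j, f i j u x) (i, x)"
| base: "i \<in> I \<Longrightarrow> j \<in> I \<Longrightarrow> basepoint i \<in> mspace (X i) \<Longrightarrow> basepoint j \<in> mspace (X j) \<Longrightarrow>
    edge w (i, basepoint i) (j, basepoint j)"

sublocale weighted_graph total edge
proof
  show "edge w p q \<Longrightarrow> edge w q p" for w p q
    by (induction rule: edge.induct) (auto intro: edge.intros simp: mdist_commute)
  show "edge w p q" if "edge v p q" "v \<le> w" for v w p q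
    using that by (induction rule: edge.induct) (auto intro: edge.intros)
  show "edge w p q \<Longrightarrow> q \<in> total" for w p q
    by (induction rule: edge.induct) (auto simp: total_def coarse_map_into[OF coarse_arrow])
  show "\<exists>n. chain edge n p q" if p: "p \<in> total" and q: "q \<in> total" for p q
  proof -
    obtain i x j y where pq: "p = (i, x)" "q = (j, y)" "i \<in> I" "j \<in> I" "x \<in> mspace (X i)" "y \<in> mspace (X j)"
      using p q by (auto simp: total_def)
    have "mdist (X i) x y \<le> real (nat \<lceil>mdist (X i) x y\<rceil>)" for i x y by linarith
    then obtain v w where "edge v (i, x) (i, basepoint i)" "edge w (j, basepoint j) (j, y)"
      using pq basepoint_in by (meson edge.fibre)
    moreover have "edge 0 (i, basepoint i) (j, basepoint j)"
      using pq by (auto intro: edge.base basepoint_in)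
    ultimately show ?thesis
      unfolding pq by (meson chain.refl chain.step)
  qed
qed

definition glued :: "('j \<times> 'a) metric" where
  "glued = graph_metric total edge"

lemma mspace_glued [simp]: "mspace glued = total"
  and mdist_glued [simp]: "mdist glued = chain_dist edge"
  by (simp_all add: glued_def)

text \<open>
  These sets turn out to be exactly the bounded sets of \<open>glued\<close>, as in a coproduct.
\<close>

definition fibrewise_bounded :: "('j \<times> 'a) set \<Rightarrow> bool" where
  "fibrewise_bounded B \<longleftrightarrow> B \<subseteq> total \<and> (\<forall>i\<in>I. bounded_in (X i) {x. (i, x) \<in> B})"

lemma fibrewise_bounded_subset: "fibrewise_bounded B \<Longrightarrow> B' \<subseteq> B \<Longrightarrow> fibrewise_bounded B'"
  unfolding fibrewise_bounded_def by (blast intro: bounded_in_subset)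

lemma fibrewise_bounded_Un:
  assumes "fibrewise_bounded B" "fibrewise_bounded B'"
  shows "fibrewise_bounded (B \<union> B')"
proof -
  have "{x. (i, x) \<in> B \<union> B'} = {x. (i, x) \<in> B} \<union> {x. (i, x) \<in> B'}" for i by auto
  then show ?thesis
    using assms by (simp add: fibrewise_bounded_def bounded_in_Un)
qed

lemma fibrewise_bounded_UN:
  assumes "finite N" "\<And>n. n \<in> N \<Longrightarrow> fibrewise_bounded (B n)"
  shows "fibrewise_bounded (\<Union>n\<in>N. B n)"
proof -
  have "{x. (i, x) \<in> (\<Union>n\<in>N. B n)} = (\<Union>n\<in>N. {x. (i, x) \<in> B n})" for i by auto
  then show ?thesis
    using assms by (auto simp: fibrewise_bounded_def intro!: bounded_in_UN)
qed

text \<open>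
  The edges that end in \<open>X j\<close> come from within \<open>X j\<close>, along arrows into \<open>j\<close>, backwards along arrows
  out of \<open>j\<close>, or from a basepoint. They contribute a metric neighbourhood, finitely many images of
  bounded sets under bornologous maps, finitely many preimages of bounded sets under proper maps,
  and at most one point.
\<close>

lemma fibrewise_bounded_neighbourhood:
  assumes "fibrewise_bounded B"
  shows "fibrewise_bounded {q. \<exists>p\<in>B. edge w p q}"
  unfolding fibrewise_bounded_def
proof (intro conjI ballI)
  show "{q. \<exists>p\<in>B. edge w p q} \<subseteq> total" using edge_in by auto
  fix j assume j: "j \<in> I"
  let ?B = "\<lambda>i. {x. (i, x) \<in> B}"
  have B: "bounded_in (X i) (?B i)" if "i \<in> I" for i
    using assms that by (simp add: fibrewise_bounded_def)
  let ?N = "{y \<in> mspace (X j). \<exists>x\<in>?B j. mdist (X j) x y \<le> real w} \<union>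
    (\<Union>i\<in>I. \<Union>u\<in>A i j. f i j u ` ?B i) \<union>
    (\<Union>i\<in>I. \<Union>u\<in>A j i. f j i u -` ?B i \<inter> mspace (X j)) \<union> ({basepoint j} \<inter> mspace (X j))"
  have "bounded_in (X j) (\<Union>i\<in>I. \<Union>u\<in>A i j. f i j u ` ?B i)"
    using coarse_arrow j
    by (intro bounded_in_UN finite_objects finite_arrows bounded_in_image[OF _ B])
      (auto simp: coarse_map_iff)
  moreover have "bounded_in (X j) (\<Union>i\<in>I. \<Union>u\<in>A j i. f j i u -` ?B i \<inter> mspace (X j))"
    by (intro bounded_in_UN finite_objects finite_arrows coarse_map_vimage[OF coarse_arrow B] j)
  moreover have "bounded_in (X j) {y \<in> mspace (X j). \<exists>x\<in>?B j. mdist (X j) x y \<le> real w}"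
    by (rule bounded_in_neighbourhood[OF B[OF j]])
  moreover have "bounded_in (X j) ({basepoint j} \<inter> mspace (X j))"
    by (rule finite_imp_bounded_in) auto
  ultimately have "bounded_in (X j) ?N"
    by (intro bounded_in_Un)
  moreover have "{y. (j, y) \<in> {q. \<exists>p\<in>B. edge w p q}} \<subseteq> ?N"
    by (auto elim!: edge.cases)
  ultimately show "bounded_in (X j) {y. (j, y) \<in> {q. \<exists>p\<in>B. edge w p q}}"
    by (rule bounded_in_subset)
qed

text \<open>
  The endpoints of chains of length \<open>n\<close> are reached by a last step of one of the finitely many
  weights \<open>w < n\<close> from the endpoints of chains of length \<open>n - Suc w\<close>.
\<close>

lemma fibrewise_bounded_chain:
  assumes "p \<in> total"
  shows "fibrewise_bounded {q. chain edge n p q}"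
proof (induction n rule: less_induct)
  case (less n)
  have "{x. (i, x) \<in> {p}} = (if i = fst p then {snd p} else {})" for i
    by (cases p) auto
  then have "fibrewise_bounded {p}"
    using assms by (auto simp: fibrewise_bounded_def total_def intro!: finite_imp_bounded_in)
  moreover have "fibrewise_bounded (\<Union>w<n. {r. \<exists>q\<in>{q. chain edge (n - Suc w) p q}. edge w q r})"
    by (intro fibrewise_bounded_UN fibrewise_bounded_neighbourhood less) auto
  ultimately have "fibrewise_bounded ({p} \<union> (\<Union>w<n. {r. \<exists>q\<in>{q. chain edge (n - Suc w) p q}. edge w q r}))"
    by (rule fibrewise_bounded_Un)
  moreover have "{r. chain edge n p r} \<subseteq>
      {p} \<union> (\<Union>w<n. {r. \<exists>q\<in>{q. chain edge (n - Suc w) p q}. edge w q r})"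
  proof
    fix r assume "r \<in> {r. chain edge n p r}"
    then have "chain edge n p r" by simp
    then show "r \<in> {p} \<union> (\<Union>w<n. {r. \<exists>q\<in>{q. chain edge (n - Suc w) p q}. edge w q r})"
    proof (cases rule: chain.cases)
      case (step m q w)
      then have "w < n" "chain edge (n - Suc w) p q" by auto
      then show ?thesis using step(3) by blast
    qed simp
  qed
  ultimately show ?case by (rule fibrewise_bounded_subset)
qed

lemma bornologous_Pair: "i \<in> I \<Longrightarrow> bornologous (X i) glued (Pair i)"
  unfolding bornologous_def
proof (intro conjI allI)
  assume i: "i \<in> I"
  show "Pair i ` mspace (X i) \<subseteq> mspace glued" using i by (auto simp: total_def)
  fix R
  have "mdist glued (i, x) (i, y) \<le> real (Suc (nat \<lceil>R\<rceil>))"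
    if "x \<in> mspace (X i)" "y \<in> mspace (X i)" "mdist (X i) x y \<le> R" for x y
  proof -
    have "mdist (X i) x y \<le> real (nat \<lceil>R\<rceil>)" using that by linarith
    then show ?thesis using i that by (simp only: mdist_glued) (intro chain_dist_le chain_edge edge.fibre)
  qed
  then show "\<exists>C. \<forall>x\<in>mspace (X i). \<forall>y\<in>mspace (X i).
      mdist (X i) x y \<le> R \<longrightarrow> mdist glued (i, x) (i, y) \<le> C" by blast
qed

lemma bounded_in_glued_iff: "bounded_in glued B \<longleftrightarrow> fibrewise_bounded B"
proof
  assume B: "fibrewise_bounded B"
  then have "bounded_in glued (\<Union>i\<in>I. Pair i ` {x. (i, x) \<in> B})"
    by (intro bounded_in_UN finite_objects bounded_in_image[OF bornologous_Pair])
      (auto simp: fibrewise_bounded_def)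
  moreover have "B \<subseteq> (\<Union>i\<in>I. Pair i ` {x. (i, x) \<in> B})"
    using B by (auto simp: fibrewise_bounded_def total_def)
  ultimately show "bounded_in glued B" by (rule bounded_in_subset)
next
  assume "bounded_in glued B"
  then obtain C where B: "B \<subseteq> total" and C: "\<forall>p\<in>B. \<forall>q\<in>B. chain_dist edge p q \<le> C"
    by (auto simp: bounded_in_iff)
  show "fibrewise_bounded B"
  proof (cases "B = {}")
    case True
    then show ?thesis by (auto simp: fibrewise_bounded_def intro: finite_imp_bounded_in)
  next
    case False
    then obtain p where p: "p \<in> B" by auto
    have "fibrewise_bounded (\<Union>n\<le>nat \<lfloor>C\<rfloor>. {q. chain edge n p q})"
      using p B by (intro fibrewise_bounded_UN fibrewise_bounded_chain) auto
    moreover have "B \<subseteq> (\<Union>n\<le>nat \<lfloor>C\<rfloor>. {q. chain edge n p q})"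
    proof
      fix q assume q: "q \<in> B"
      obtain n where "chain edge n p q" "real n = chain_dist edge p q"
        using chain_of_dist[of p q] p q B by blast
      moreover have "n \<le> nat \<lfloor>C\<rfloor>" using calculation(2) C p q by (simp add: le_nat_floor)
      ultimately show "q \<in> (\<Union>n\<le>nat \<lfloor>C\<rfloor>. {q. chain edge n p q})" by auto
    qed
    ultimately show ?thesis by (rule fibrewise_bounded_subset)
  qed
qed

lemma coarse_map_Pair: "i \<in> I \<Longrightarrow> coarse_map (X i) glued (Pair i)"
  unfolding coarse_map_iff bounded_in_glued_iff
  by (auto simp: bornologous_Pair fibrewise_bounded_def vimage_def intro: bounded_in_subset)

lemma map_cocone_glued: "map_cocone I A X f glued Pair"
  unfolding map_cocone_def
proof (intro conjI ballI coarse_map_Pair)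
  fix i j u assume "i \<in> I" "j \<in> I" "u \<in> A i j"
  then have "chain_dist edge (j, f i j u x) (i, x) \<le> real (Suc 0)" if "x \<in> mspace (X i)" for x
    using that by (intro chain_dist_le chain_edge edge.arrow_rev)
  then show "close_maps (X i) glued (Pair j \<circ> f i j u) (Pair i)"
    unfolding close_maps_iff by auto
qed

text \<open>
  Edges within a fibre are controlled by the legs, edges along arrows by the closeness that makes
  \<open>\<phi>\<close> a cocone, and edges between basepoints by the finitely many distances that occur. Properness
  needs no estimate: the preimage of a bounded set meets \<open>X i\<close> in its preimage under \<open>\<phi> i\<close>.
\<close>

lemma coarse_map_case_prod:
  assumes c: "map_cocone I A X f Z \<phi>"
  shows "coarse_map glued Z (case_prod \<phi>)"
proof -
  note \<phi> = map_coconeD[OF c]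
  have into: "case_prod \<phi> ` total \<subseteq> mspace Z"
    using coarse_map_into[OF \<phi>(1)] by (auto simp: total_def)
  have "\<exists>C. \<forall>p q. edge w p q \<longrightarrow> mdist Z (case_prod \<phi> p) (case_prod \<phi> q) \<le> C" for w
  proof -
    have "\<forall>i\<in>I. \<exists>C. \<forall>x\<in>mspace (X i). \<forall>y\<in>mspace (X i). mdist (X i) x y \<le> real w \<longrightarrow> mdist Z (\<phi> i x) (\<phi> i y) \<le> C"
      using coarse_map_bound[OF \<phi>(1)] by blast
    then obtain C where C: "\<forall>i\<in>I. \<forall>x\<in>mspace (X i). \<forall>y\<in>mspace (X i). mdist (X i) x y \<le> real w \<longrightarrow> mdist Z (\<phi> i x) (\<phi> i y) \<le> C i"
      by (rule bchoice[THEN exE])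
    have "\<exists>D. \<forall>i\<in>I. \<forall>j\<in>I. \<forall>u\<in>A i j. \<forall>x\<in>mspace (X i). mdist Z (\<phi> j (f i j u x)) (\<phi> i x) \<le> D i j u"
      using \<phi>(2) unfolding close_maps_iff comp_apply by metis
    then obtain D where D: "\<forall>i\<in>I. \<forall>j\<in>I. \<forall>u\<in>A i j. \<forall>x\<in>mspace (X i). mdist Z (\<phi> j (f i j u x)) (\<phi> i x) \<le> D i j u" ..
    let ?b = "\<lambda>i. \<phi> i (basepoint i)"
    define K where "K = C ` I \<union> (\<Union>i\<in>I. \<Union>j\<in>I. D i j ` A i j) \<union> (\<Union>i\<in>I. (\<lambda>j. mdist Z (?b i) (?b j)) ` I)"
    have "finite K" unfolding K_def using finite_objects finite_arrows by blast
    moreover have "\<exists>k\<in>K. mdist Z (case_prod \<phi> p) (case_prod \<phi> q) \<le> k" if "edge w p q" for p q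
      using that
    proof (cases rule: edge.cases)
      case (fibre i x y)
      then have "C i \<in> K" by (simp add: K_def)
      moreover have "mdist Z (\<phi> i x) (\<phi> i y) \<le> C i" using fibre C by blast
      ultimately show ?thesis using fibre by auto
    next
      case (arrow i j u x)
      then have "D i j u \<in> K" unfolding K_def by blast
      moreover have "mdist Z (\<phi> j (f i j u x)) (\<phi> i x) \<le> D i j u" using arrow D by blast
      ultimately show ?thesis using arrow by (auto simp: mdist_commute[of Z "\<phi> i x"])
    next
      case (arrow_rev i j u x)
      then have "D i j u \<in> K" unfolding K_def by blast
      moreover have "mdist Z (\<phi> j (f i j u x)) (\<phi> i x) \<le> D i j u" using arrow_rev D by blast
      ultimately show ?thesis using arrow_rev by auto
    next
      case (base i j)
      then have "mdist Z (?b i) (?b j) \<in> K" unfolding K_def by blast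
      then show ?thesis using base by auto
    qed
    ultimately have "mdist Z (case_prod \<phi> p) (case_prod \<phi> q) \<le> Max K" if "edge w p q" for p q
      using that by (meson Max_ge order_trans)
    then show ?thesis by blast
  qed
  then have "bornologous glued Z (case_prod \<phi>)"
    unfolding glued_def using into by (rule bornologous_graph_metric[rotated])
  moreover have "fibrewise_bounded (case_prod \<phi> -` B \<inter> total)" if "bounded_in Z B" for B
    using coarse_map_vimage[OF \<phi>(1) that] unfolding fibrewise_bounded_def
    by (auto simp: total_def vimage_def intro: bounded_in_subset)
  ultimately show ?thesis by (simp add: coarse_map_iff bounded_in_glued_iff)
qed

lemma close_maps_glued:
  assumes "coarse_map glued Z h" "coarse_map glued Z h'"
    and "\<And>i. i \<in> I \<Longrightarrow> close_maps (X i) Z (h \<circ> Pair i) (h' \<circ> Pair i)"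
  shows "close_maps glued Z h h'"
proof -
  have "mspace glued = (\<Union>i\<in>I. Pair i ` mspace (X i))"
    by (auto simp: total_def)
  then show ?thesis
    using assms(3) finite_objects
    by (simp add: close_maps_def image_UN image_image bdd_above_UN comp_def)
qed

lemma map_universal_glued: "map_universal I A X f glued Pair TYPE('b)"
  unfolding map_universal_def
proof (intro allI impI conjI)
  fix Z :: "'b metric" and \<phi>
  assume c: "map_cocone I A X f Z \<phi>"
  note \<phi> = map_coconeD[OF c]
  have "factors_through I X glued Pair Z \<phi> (case_prod \<phi>)"
    unfolding factors_through_def
    using coarse_map_case_prod[OF c] close_maps_refl[OF \<phi>(1)] by (simp add: comp_def)
  then show "\<exists>h. factors_through I X glued Pair Z \<phi> h" by blast
  fix h h' assume h: "factors_through I X glued Pair Z \<phi> h" and h': "factors_through I X glued Pair Z \<phi> h'"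
  note hc = factors_throughD(1)[OF h] and hc' = factors_throughD(1)[OF h']
  show "close_maps glued Z h h'"
    using hc hc'
  proof (rule close_maps_glued)
    fix i assume i: "i \<in> I"
    show "close_maps (X i) Z (h \<circ> Pair i) (h' \<circ> Pair i)"
      by (rule close_maps_trans[OF coarse_map_comp[OF coarse_map_Pair[OF i] hc] \<phi>(1)[OF i]
            coarse_map_comp[OF coarse_map_Pair[OF i] hc'] factors_throughD(2)[OF h i]
            close_maps_sym[OF factors_throughD(2)[OF h' i]]])
  qed
qed

end


section \<open>Changing the underlying set up to coarse equivalence\<close>

text \<open>
  A coarsely dense subset \<open>T\<close> of \<open>V\<close> is coarsely equivalent to \<open>V\<close> by any map \<open>r\<close> that moves points
  into \<open>T\<close> by a bounded amount, and its metric can be carried along any injection of \<open>T\<close>.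
\<close>

lemma coarse_equivalent_metric_on_image:
  fixes V :: "'v metric" and e :: "'v \<Rightarrow> 'w"
  assumes T: "T \<subseteq> mspace V" and e: "inj_on e T"
    and r: "r ` mspace V \<subseteq> T" "\<And>x. x \<in> mspace V \<Longrightarrow> mdist V (r x) x \<le> C"
  shows "\<exists>(W :: 'w metric) s t. coarse_map V W s \<and> coarse_map W V t \<and>
    close_maps V V (t \<circ> s) id \<and> close_maps W W (s \<circ> t) id"
proof -
  define t where "t = inv_into T e"
  have te: "t (e x) = x" if "x \<in> T" for x using that e by (simp add: t_def)
  have et: "e (t w) = w" "t w \<in> T" if "w \<in> e ` T" for w
    using that by (simp_all add: t_def f_inv_into_f inv_into_into)
  define W where "W = metric (e ` T, \<lambda>v w. mdist V (t v) (t w))"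
  have "Metric_space (e ` T) (\<lambda>v w. mdist V (t v) (t w))"
  proof
    show "mdist V (t v) (t w) = 0 \<longleftrightarrow> v = w" if "v \<in> e ` T" "w \<in> e ` T" for v w
      using et[OF that(1)] et[OF that(2)] T by (metis mdist_zero subsetD)
    show "mdist V (t u) (t w) \<le> mdist V (t u) (t v) + mdist V (t v) (t w)"
      if "u \<in> e ` T" "v \<in> e ` T" "w \<in> e ` T" for u v w
      by (rule mdist_triangle) (use that et(2) T in auto)
  qed (simp_all add: mdist_commute)
  then have W [simp]: "mspace W = e ` T" "mdist W = (\<lambda>v w. mdist V (t v) (t w))"
    by (simp_all add: W_def Metric_space.mspace_metric Metric_space.mdist_metric)
  have rT: "r x \<in> T" "r x \<in> mspace V" if "x \<in> mspace V" for x using that r(1) T by auto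
  have "coarse_map V W (e \<circ> r)"
  proof (rule rough_isometric_embedding_imp_coarse)
    show "(e \<circ> r) ` mspace V \<subseteq> mspace W" using rT by auto
    fix x y assume x: "x \<in> mspace V" and y: "y \<in> mspace V"
    have "mdist V (r x) (r y) \<le> mdist V (r x) x + (mdist V x y + mdist V y (r y))"
      using mdist_triangle[of "r x" V x "r y"] mdist_triangle[of x V y "r y"] x y rT by auto
    moreover have "mdist V x y \<le> mdist V x (r x) + (mdist V (r x) (r y) + mdist V (r y) y)"
      using mdist_triangle[of x V "r x" y] mdist_triangle[of "r x" V "r y" y] x y rT by auto
    ultimately have "\<bar>mdist V (r x) (r y) - mdist V x y\<bar> \<le> 2 * C"
      using r(2)[OF x] r(2)[OF y] mdist_commute[of V x "r x"] mdist_commute[of V y "r y"] by linarith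
    then show "\<bar>mdist W ((e \<circ> r) x) ((e \<circ> r) y) - mdist V x y\<bar> \<le> 2 * C"
      using te[OF rT(1)[OF x]] te[OF rT(1)[OF y]] by simp
  qed
  moreover have "coarse_map W V t"
    by (rule rough_isometric_embedding_imp_coarse[where K = 0]) (use et(2) T in auto)
  moreover have "close_maps V V (t \<circ> (e \<circ> r)) id"
    unfolding close_maps_iff by (rule exI[of _ C]) (simp add: te rT r(2))
  moreover have "close_maps W W ((e \<circ> r) \<circ> t) id"
    unfolding close_maps_iff
  proof (intro exI[of _ C] ballI)
    fix w assume "w \<in> mspace W"
    then have "t w \<in> mspace V" using et(2) T by auto
    then show "mdist W (((e \<circ> r) \<circ> t) w) (id w) \<le> C" by (simp add: te rT r(2))
  qed
  ultimately show ?thesis by blast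
qed

lemma infinite_imp_inj_on_finite_Times:
  fixes I :: "'j set"
  assumes "infinite (UNIV :: 'a set)" "finite I"
  shows "\<exists>e :: 'j \<times> 'a \<Rightarrow> 'a. inj_on e (I \<times> UNIV)"
proof -
  have "(card_of I, card_of (UNIV :: 'a set)) \<in> ordLeq"
    using finite_lepoll_infinite[OF assms] by (auto simp: lepoll_def intro: card_of_ordLeqI)
  then have "(card_of (I \<times> (UNIV :: 'a set)), card_of (UNIV :: 'a set)) \<in> ordLeq"
    using assms(1) by (intro card_of_Sigma_ordLeq_infinite) (auto intro: card_of_mono1)
  then show ?thesis unfolding card_of_ordLeq[symmetric] by auto
qed

lemma ex_coarse_equivalent_metric_on_factor:
  fixes V :: "('j \<times> 'a) metric"
  assumes I: "finite I" and V: "mspace V \<subseteq> I \<times> UNIV"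
  shows "\<exists>(W :: 'a metric) s t. coarse_map V W s \<and> coarse_map W V t \<and>
    close_maps V V (t \<circ> s) id \<and> close_maps W W (s \<circ> t) id"
proof (cases "finite (UNIV :: 'a set)")
  case True
  then have "finite (mspace V)" using V I by (meson finite_SigmaI finite_subset)
  then have "bounded_in V (mspace V)" by (simp add: finite_imp_bounded_in)
  then obtain C where C: "\<And>x y. x \<in> mspace V \<Longrightarrow> y \<in> mspace V \<Longrightarrow> mdist V x y \<le> C"
    by (auto simp: bounded_in_iff)
  define p where "p = (SOME x. x \<in> mspace V)"
  have p: "p \<in> mspace V" if "x \<in> mspace V" for x using that unfolding p_def by (rule someI)
  \<comment> \<open>A bounded space is coarsely a point. The intersection covers the empty space, where \<open>p\<close> is arbitrary.\<close>
  show ?thesis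
    by (rule coarse_equivalent_metric_on_image[where T = "{p} \<inter> mspace V" and r = "\<lambda>_. p"
          and e = snd and C = C]) (use p C in \<open>auto simp: inj_on_def\<close>)
next
  case False
  then obtain e :: "'j \<times> 'a \<Rightarrow> 'a" where "inj_on e (I \<times> UNIV)"
    using infinite_imp_inj_on_finite_Times[OF _ I] by blast
  then show ?thesis
    by (intro coarse_equivalent_metric_on_image[where T = "mspace V" and r = id and e = e and C = 0])
      (use V in \<open>auto intro: inj_on_subset simp: mdist_self\<close>)
qed

context finite_coarse_diagram
begin

text \<open>
  One and the same cocone over \<open>'a\<close> is universal for both types of test spaces, which is what
  permits the universal property of any other colimit to be moved from \<open>'a\<close> to \<open>'b\<close>.
\<close>

lemma ex_map_universal:
  "\<exists>(V :: 'a metric) \<iota>. map_cocone I A X f V \<iota> \<and> map_universal I A X f V \<iota> TYPE('a) \<and>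
     map_universal I A X f V \<iota> TYPE('b)"
proof -
  have "mspace glued \<subseteq> I \<times> UNIV" by (auto simp: total_def)
  then obtain V :: "'a metric" and s t where s: "coarse_map glued V s" and t: "coarse_map V glued t"
    and ts: "close_maps glued glued (t \<circ> s) id" and st: "close_maps V V (s \<circ> t) id"
    using ex_coarse_equivalent_metric_on_factor[OF finite_objects] by blast
  have c: "map_cocone I A X f V (\<lambda>i. s \<circ> Pair i)"
    using coarse_arrow map_cocone_glued s by (rule map_cocone_transport)
  have "factors_through I X glued Pair V (\<lambda>i. s \<circ> Pair i) s"
    unfolding factors_through_def using s close_maps_refl[OF map_coconeD(1)[OF c]] by blast
  note transport = map_universal_transport[OF coarse_map_Pair map_coconeD(1)[OF c] this t ts st
      map_universal_glued]
  show ?thesis using c transport[where ?'b = 'a] transport[where ?'b = 'b] by blast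
qed

end


section \<open>From representatives to closeness classes\<close>

lemma coarse_cocone_iff_map_cocone:
  fixes \<phi> :: "'j \<Rightarrow> ('a \<Rightarrow> 'b) set"
  assumes d: "\<And>i j u. i \<in> Obj \<J> \<Longrightarrow> j \<in> Obj \<J> \<Longrightarrow> u \<in> Hom \<J> i j \<Longrightarrow>
      coarse_map (X i) (X j) (f i j u) \<and> F i j u = closeness_class (X i) (X j) (f i j u)"
  shows "coarse_cocone \<J> X F Z \<phi> \<longleftrightarrow>
    (\<exists>\<psi>. map_cocone (Obj \<J>) (Hom \<J>) X f Z \<psi> \<and> (\<forall>i\<in>Obj \<J>. \<phi> i = closeness_class (X i) Z (\<psi> i)))"
proof
  assume c: "coarse_cocone \<J> X F Z \<phi>"
  have "\<forall>i\<in>Obj \<J>. \<exists>g. coarse_map (X i) Z g \<and> \<phi> i = closeness_class (X i) Z g"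
    using c by (simp add: coarse_cocone_def coarse_hom_iff)
  then obtain \<psi> where \<psi>: "\<forall>i\<in>Obj \<J>. coarse_map (X i) Z (\<psi> i) \<and> \<phi> i = closeness_class (X i) Z (\<psi> i)"
    by (rule bchoice[THEN exE])
  have "close_maps (X i) Z (\<psi> j \<circ> f i j u) (\<psi> i)"
    if "i \<in> Obj \<J>" "j \<in> Obj \<J>" "u \<in> Hom \<J> i j" for i j u
  proof -
    have "coarse_comp (X i) Z (\<phi> j) (F i j u) = \<phi> i"
      using c that by (simp add: coarse_cocone_def)
    then have "closeness_class (X i) Z (\<psi> j \<circ> f i j u) = closeness_class (X i) Z (\<psi> i)"
      using \<psi> that d[OF that] by (simp add: coarse_comp_closeness_class)
    moreover have "coarse_map (X i) Z (\<psi> j \<circ> f i j u)"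
      using \<psi> that d[OF that] by (blast intro: coarse_map_comp)
    ultimately show ?thesis
      using \<psi> that by (simp add: closeness_class_eq_iff)
  qed
  then show "\<exists>\<psi>. map_cocone (Obj \<J>) (Hom \<J>) X f Z \<psi> \<and> (\<forall>i\<in>Obj \<J>. \<phi> i = closeness_class (X i) Z (\<psi> i))"
    using \<psi> unfolding map_cocone_def by blast
next
  assume "\<exists>\<psi>. map_cocone (Obj \<J>) (Hom \<J>) X f Z \<psi> \<and> (\<forall>i\<in>Obj \<J>. \<phi> i = closeness_class (X i) Z (\<psi> i))"
  then obtain \<psi> where c: "map_cocone (Obj \<J>) (Hom \<J>) X f Z \<psi>"
    and \<psi>: "\<forall>i\<in>Obj \<J>. \<phi> i = closeness_class (X i) Z (\<psi> i)" by blast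
  note \<psi>c = map_coconeD[OF c]
  have "coarse_comp (X i) Z (\<phi> j) (F i j u) = \<phi> i"
    if "i \<in> Obj \<J>" "j \<in> Obj \<J>" "u \<in> Hom \<J> i j" for i j u
  proof -
    have "coarse_comp (X i) Z (\<phi> j) (F i j u) = closeness_class (X i) Z (\<psi> j \<circ> f i j u)"
      using \<psi> \<psi>c(1) that d[OF that] by (simp add: coarse_comp_closeness_class)
    also have "\<dots> = closeness_class (X i) Z (\<psi> i)"
      using closeness_class_eq_iff[OF coarse_map_comp \<psi>c(1)] \<psi>c that d[OF that] by blast
    finally show ?thesis using \<psi> that by simp
  qed
  then show "coarse_cocone \<J> X F Z \<phi>"
    using \<psi> \<psi>c(1) by (simp add: coarse_cocone_def closeness_class_in_coarse_hom)
qed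

lemma factors_through_iff:
  assumes \<kappa>: "\<And>i. i \<in> I \<Longrightarrow> coarse_map (X i) V (\<kappa> i) \<and> \<iota> i = closeness_class (X i) V (\<kappa> i)"
    and \<psi>: "\<And>i. i \<in> I \<Longrightarrow> coarse_map (X i) Z (\<psi> i) \<and> \<phi> i = closeness_class (X i) Z (\<psi> i)"
    and h: "coarse_map V Z h"
  shows "(\<forall>i\<in>I. coarse_comp (X i) Z (closeness_class V Z h) (\<iota> i) = \<phi> i) \<longleftrightarrow>
    factors_through I X V \<kappa> Z \<psi> h"
proof -
  have "coarse_comp (X i) Z (closeness_class V Z h) (\<iota> i) = \<phi> i \<longleftrightarrow> close_maps (X i) Z (h \<circ> \<kappa> i) (\<psi> i)"
    if "i \<in> I" for i
    using \<kappa>[OF that] \<psi>[OF that] h coarse_map_comp[of "X i" V "\<kappa> i" Z h]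
    by (simp add: coarse_comp_closeness_class closeness_class_eq_iff)
  then show ?thesis unfolding factors_through_def using h by blast
qed

text \<open>
  Closeness of representatives is equality of classes, so unique existence of a factorising class
  splits into existence of a factorising map and closeness of any two of them.
\<close>

lemma coarse_universal_iff_map_universal:
  fixes V :: "'a metric"
  assumes d: "\<And>i j u. i \<in> Obj \<J> \<Longrightarrow> j \<in> Obj \<J> \<Longrightarrow> u \<in> Hom \<J> i j \<Longrightarrow>
      coarse_map (X i) (X j) (f i j u) \<and> F i j u = closeness_class (X i) (X j) (f i j u)"
    and \<kappa>: "\<And>i. i \<in> Obj \<J> \<Longrightarrow> coarse_map (X i) V (\<kappa> i) \<and> \<iota> i = closeness_class (X i) V (\<kappa> i)"
  shows "coarse_universal \<J> X F V \<iota> TYPE('b) \<longleftrightarrow>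
    map_universal (Obj \<J>) (Hom \<J>) X f V \<kappa> TYPE('b)"
proof -
  let ?I = "Obj \<J>" and ?A = "Hom \<J>"
  have iff: "(\<exists>!h. h \<in> coarse_hom V Z \<and> (\<forall>i\<in>?I. coarse_comp (X i) Z h (\<iota> i) = \<phi> i)) \<longleftrightarrow>
      (\<exists>h. factors_through ?I X V \<kappa> Z \<psi> h) \<and>
      (\<forall>h h'. factors_through ?I X V \<kappa> Z \<psi> h \<longrightarrow> factors_through ?I X V \<kappa> Z \<psi> h' \<longrightarrow>
         close_maps V Z h h')"
    if c: "map_cocone ?I ?A X f Z \<psi>" and \<psi>: "\<forall>i\<in>?I. \<phi> i = closeness_class (X i) Z (\<psi> i)"
    for Z :: "'b metric" and \<phi> \<psi>
  proof -
    have f: "(\<forall>i\<in>?I. coarse_comp (X i) Z (closeness_class V Z h) (\<iota> i) = \<phi> i) \<longleftrightarrow>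
        factors_through ?I X V \<kappa> Z \<psi> h" if "coarse_map V Z h" for h
      by (rule factors_through_iff) (use \<kappa> \<psi> map_coconeD(1)[OF c] that in auto)
    have hom: "(h \<in> coarse_hom V Z \<and> (\<forall>i\<in>?I. coarse_comp (X i) Z h (\<iota> i) = \<phi> i)) \<longleftrightarrow>
        (\<exists>g. factors_through ?I X V \<kappa> Z \<psi> g \<and> h = closeness_class V Z g)" for h
    proof
      assume h: "h \<in> coarse_hom V Z \<and> (\<forall>i\<in>?I. coarse_comp (X i) Z h (\<iota> i) = \<phi> i)"
      then obtain g where "coarse_map V Z g" "h = closeness_class V Z g" by (blast elim: coarse_homE)
      then show "\<exists>g. factors_through ?I X V \<kappa> Z \<psi> g \<and> h = closeness_class V Z g"
        using h f by blast
    next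
      assume "\<exists>g. factors_through ?I X V \<kappa> Z \<psi> g \<and> h = closeness_class V Z g"
      then obtain g where g: "factors_through ?I X V \<kappa> Z \<psi> g" "h = closeness_class V Z g" by blast
      then show "h \<in> coarse_hom V Z \<and> (\<forall>i\<in>?I. coarse_comp (X i) Z h (\<iota> i) = \<phi> i)"
        using f[OF factors_throughD(1)[OF g(1)]] factors_throughD(1)[OF g(1)]
        by (simp add: closeness_class_in_coarse_hom)
    qed
    have eq: "closeness_class V Z g = closeness_class V Z g' \<longleftrightarrow> close_maps V Z g g'"
      if "factors_through ?I X V \<kappa> Z \<psi> g" "factors_through ?I X V \<kappa> Z \<psi> g'" for g g'
      using that[THEN factors_throughD(1)] by (rule closeness_class_eq_iff)
    have ex1: "(\<exists>!h. \<exists>g. P g \<and> h = c g) \<longleftrightarrow> (\<exists>g. P g) \<and> (\<forall>g g'. P g \<longrightarrow> P g' \<longrightarrow> c g = c g')"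
      for P :: "('a \<Rightarrow> 'b) \<Rightarrow> bool" and c :: "('a \<Rightarrow> 'b) \<Rightarrow> ('a \<Rightarrow> 'b) set"
      by (auto simp: Ex1_def)
    show ?thesis unfolding hom ex1 using eq by blast
  qed
  show ?thesis
    unfolding coarse_universal_def map_universal_def
  proof (intro iffI allI impI)
    fix Z :: "'b metric" and \<psi>
    assume u: "\<forall>(Z :: 'b metric) \<phi>. coarse_cocone \<J> X F Z \<phi> \<longrightarrow>
        (\<exists>!h. h \<in> coarse_hom V Z \<and> (\<forall>i\<in>?I. coarse_comp (X i) Z h (\<iota> i) = \<phi> i))"
      and c: "map_cocone ?I ?A X f Z \<psi>"
    let ?\<phi> = "\<lambda>i. closeness_class (X i) Z (\<psi> i)"
    have "coarse_cocone \<J> X F Z ?\<phi>"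
      using c by (subst coarse_cocone_iff_map_cocone[where f = f, OF d]) auto
    then have "\<exists>!h. h \<in> coarse_hom V Z \<and> (\<forall>i\<in>?I. coarse_comp (X i) Z h (\<iota> i) = ?\<phi> i)"
      using u by blast
    then show "(\<exists>h. factors_through ?I X V \<kappa> Z \<psi> h) \<and>
      (\<forall>h h'. factors_through ?I X V \<kappa> Z \<psi> h \<longrightarrow> factors_through ?I X V \<kappa> Z \<psi> h' \<longrightarrow>
         close_maps V Z h h')"
      using iff[OF c, of ?\<phi>] by blast
  next
    fix Z :: "'b metric" and \<phi>
    assume u: "\<forall>(Z :: 'b metric) \<phi>. map_cocone ?I ?A X f Z \<phi> \<longrightarrow>
        (\<exists>h. factors_through ?I X V \<kappa> Z \<phi> h) \<and>
        (\<forall>h h'. factors_through ?I X V \<kappa> Z \<phi> h \<longrightarrow> factors_through ?I X V \<kappa> Z \<phi> h' \<longrightarrow>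
           close_maps V Z h h')"
      and c: "coarse_cocone \<J> X F Z \<phi>"
    obtain \<psi> where \<psi>: "map_cocone ?I ?A X f Z \<psi>" "\<forall>i\<in>?I. \<phi> i = closeness_class (X i) Z (\<psi> i)"
      using c coarse_cocone_iff_map_cocone[where f = f and F = F, OF d] by blast
    show "\<exists>!h. h \<in> coarse_hom V Z \<and> (\<forall>i\<in>?I. coarse_comp (X i) Z h (\<iota> i) = \<phi> i)"
      unfolding iff[OF \<psi>] using u \<psi>(1) by blast
  qed
qed

lemma is_colimit_coarse_category_iff:
  "is_colimit \<J> coarse_category X F (V :: 'a metric) \<iota> \<longleftrightarrow>
     coarse_cocone \<J> X F V \<iota> \<and> coarse_universal \<J> X F V \<iota> TYPE('a)"
  by (simp add: is_colimit_def is_cocone_def coarse_cocone_def coarse_universal_def coarse_category_def)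

lemma functor_to_coarse_category_reps:
  assumes "is_functor \<J> coarse_category X F"
  obtains f where "\<And>i j u. i \<in> Obj \<J> \<Longrightarrow> j \<in> Obj \<J> \<Longrightarrow> u \<in> Hom \<J> i j \<Longrightarrow>
    coarse_map (X i) (X j) (f i j u) \<and> F i j u = closeness_class (X i) (X j) (f i j u)"
proof
  let ?P = "\<lambda>i j u g. coarse_map (X i) (X j) g \<and> F i j u = closeness_class (X i) (X j) g"
  fix i j u assume "i \<in> Obj \<J>" "j \<in> Obj \<J>" "u \<in> Hom \<J> i j"
  then have "F i j u \<in> coarse_hom (X i) (X j)"
    using assms by (simp add: is_functor_def coarse_category_def)
  then have "\<exists>g. ?P i j u g" by (simp add: coarse_hom_iff)
  then show "?P i j u (SOME g. ?P i j u g)" by (rule someI_ex)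
qed

theorem theorem35:
  shows "is_category (coarse_category :: ('a metric, ('a \<Rightarrow> 'a) set) cat) \<and>
    (\<forall>\<J> :: ('j, 'k) cat. finite_category \<J> \<longrightarrow>
      has_colimits_of_shape \<J> (coarse_category :: ('a metric, ('a \<Rightarrow> 'a) set) cat) \<and>
      (\<forall>F\<^sub>O F\<^sub>M (V :: 'a metric) \<iota>.
        is_functor \<J> coarse_category F\<^sub>O F\<^sub>M \<and> is_colimit \<J> coarse_category F\<^sub>O F\<^sub>M V \<iota> \<longrightarrow>
        coarse_universal \<J> F\<^sub>O F\<^sub>M V \<iota> TYPE('b)))"
proof (intro conjI allI impI is_category_coarse_category)
  fix \<J> :: "('j, 'k) cat"
  assume fin: "finite_category \<J>"
  \<comment> \<open>The colimit cocone \<open>V\<close> is fixed before an arbitrary colimit \<open>W\<close> is compared with it.\<close>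
  have key: "(\<exists>V \<iota>. is_colimit \<J> coarse_category X F V \<iota>) \<and>
      (\<forall>V \<iota>. is_colimit \<J> coarse_category X F V \<iota> \<longrightarrow> coarse_universal \<J> X F V \<iota> TYPE('b))"
    if "is_functor \<J> coarse_category X F" for X :: "'j \<Rightarrow> 'a metric" and F
  proof -
    obtain f where d: "\<And>i j u. i \<in> Obj \<J> \<Longrightarrow> j \<in> Obj \<J> \<Longrightarrow> u \<in> Hom \<J> i j \<Longrightarrow>
        coarse_map (X i) (X j) (f i j u) \<and> F i j u = closeness_class (X i) (X j) (f i j u)"
      using functor_to_coarse_category_reps[OF \<open>is_functor \<J> coarse_category X F\<close>] by blast
    interpret finite_coarse_diagram "Obj \<J>" "Hom \<J>" X f
      using fin d by unfold_locales (auto simp: finite_category_def)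
    let ?univ = "map_universal (Obj \<J>) (Hom \<J>) X f"
    obtain V :: "'a metric" and \<kappa> where c: "map_cocone (Obj \<J>) (Hom \<J>) X f V \<kappa>"
      and u: "?univ V \<kappa> TYPE('a)" "?univ V \<kappa> TYPE('b)"
      using ex_map_universal[where ?'b = 'b] by blast
    let ?\<iota> = "\<lambda>i. closeness_class (X i) V (\<kappa> i)"
    have "coarse_cocone \<J> X F V ?\<iota>"
      using c by (subst coarse_cocone_iff_map_cocone[where f = f, OF d]) auto
    moreover have "coarse_universal \<J> X F V ?\<iota> TYPE('a)"
      using u(1) map_coconeD(1)[OF c]
      by (subst coarse_universal_iff_map_universal[where f = f and \<kappa> = \<kappa>, OF d]) auto
    ultimately have "is_colimit \<J> coarse_category X F V ?\<iota>"
      by (simp add: is_colimit_coarse_category_iff)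
    moreover have "coarse_universal \<J> X F W \<iota> TYPE('b)"
      if "is_colimit \<J> coarse_category X F W \<iota>" for W \<iota>
    proof -
      have W: "coarse_cocone \<J> X F W \<iota>" "coarse_universal \<J> X F W \<iota> TYPE('a)"
        using that by (simp_all add: is_colimit_coarse_category_iff)
      obtain \<mu> where cW: "map_cocone (Obj \<J>) (Hom \<J>) X f W \<mu>"
        and l: "\<forall>i\<in>Obj \<J>. \<iota> i = closeness_class (X i) W (\<mu> i)"
        using W(1) coarse_cocone_iff_map_cocone[where f = f and F = F, OF d] by blast
      have reps: "coarse_map (X i) W (\<mu> i) \<and> \<iota> i = closeness_class (X i) W (\<mu> i)" if "i \<in> Obj \<J>" for i
        using that l map_coconeD(1)[OF cW] by blast
      have "?univ W \<mu> TYPE('a)"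
        using W(2) coarse_universal_iff_map_universal[where f = f and F = F, OF d reps] by blast
      then have "?univ W \<mu> TYPE('b)" by (rule map_universal_change_test_type[OF c u cW])
      then show ?thesis
        using coarse_universal_iff_map_universal[where f = f and F = F, OF d reps] by blast
    qed
    ultimately show ?thesis by blast
  qed
  show "has_colimits_of_shape \<J> (coarse_category :: ('a metric, ('a \<Rightarrow> 'a) set) cat)"
    unfolding has_colimits_of_shape_def using key by blast
  show "coarse_universal \<J> F\<^sub>O F\<^sub>M V \<iota> TYPE('b)"
    if "is_functor \<J> coarse_category F\<^sub>O F\<^sub>M \<and> is_colimit \<J> coarse_category F\<^sub>O F\<^sub>M V \<iota>"
    for F\<^sub>O F\<^sub>M and V :: "'a metric" and \<iota>
    using key that by blast
qed

end
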